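(* Let $r\in\,]0,1[$ and $\alpha=\frac{1+r}{2}$. Let $$X=\{(x,y,z)\in\mathbb{R}^3 : x^2+y^2+z^2=1\}\cap\Big[\{x\ge 0,\ z\le 0\}\cup\{x\le 0,\ z\ge 0\}\Big],$$ and let $\widehat{\mathfrak{P}}$ be the $\mathfrak{b}$-to-$\mathfrak{b}$ mapping on $X$, defined by the algorithm given in the context, its values being regarded as elements of the projective plane $\mathbb{P}_2(\mathbb{R})$ (unit vectors up to sign). Define the matrices $$P_1=\begin{pmatrix}-r & r\alpha & 0\\ -\alpha & \alpha^2-r & r\alpha\\ 0&0&r^2\end{pmatrix},\quad P_2=P_4=\begin{pmatrix} r&-r\alpha&0\\ \alpha&-2\alpha^2+r&\alpha\\ 0&-r\alpha&r\end{pmatrix},\quad P_3=\begin{pmatrix} r^2&0&0\\ r\alpha&\alpha^2-r&-\alpha\\ 0&r\alpha&-r\end{pmatrix}.$$ For $u={}^t(x,y,z)$ with $x>0$ and $z<0$, set $$\mathfrak{P}(u)=\begin{cases}P_1u & \text{if } y>0,\ \alpha y-x>0,\\ P_2u & \text{if } y>0,\ \alpha y-x<0,\\ P_3u & \text{if } y<0,\ \alpha y-z<0,\\ P_4u & \text{if } y<0,\ \alpha y-z>0,\end{cases}$$ and for $x<0$, $z>0$ set $\mathfrak{P}(u)=-\mathfrak{P}(-u)$. Then $\widehat{\mathfrak{P}}$ coincides almost everywhere on $X$ with the piecewise projective linear transformation associated with $\mathfrak{P}$; more precisely, as elements of $\mathbb{P}_2(\mathbb{R})$, $$\widehat{\mathfrak{P}}(u)=\frac{\mathfrak{P}(u)}{|\mathfrak{P}(u)|}$$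 for all $u={}^t(x,y,z)\in X$ such that $x\ne0$, $y\neq 0$, $z\neq0$, $\alpha y-x\neq0$ and $\alpha y-z\ne0$.
   Context: Let $(e_x,e_y,e_z)$ be the canonical basis of $\mathbb{R}^3$, $\wedge$ the cross product, $\cdot$ the Euclidean scalar product, $|\cdot|$ the Euclidean norm, and ${}^t(x,y,z)$ the column vector. The number $r$ is the restitution coefficient of a system of four one-dimensional inelastic particles, and $\alpha=\frac{1+r}{2}$. The collision matrices are $$A=\begin{pmatrix}-r&0&0\\ \alpha&1&0\\0&0&1\end{pmatrix},\quad B=\begin{pmatrix}1&\alpha&0\\0&-r&0\\0&\alpha&1\end{pmatrix},\quad C=\begin{pmatrix}1&0&0\\0&1&\alpha\\0&0&-r\end{pmatrix}.$$ The $\mathfrak{b}$-to-$\mathfrak{b}$ mapping $\widehat{\mathfrak{P}}$ acts on a unit vector $u$ (normal vector of a plane, hence considered up to sign) through the following algorithm. 1. If $u\cdot e_x<0$, replace $u$ by $-u$. 2. Set the variable contact to $\mathfrak{b}$. 3. Do exactly one of the following, according to the current value of contact. - If contact $=\mathfrak{a}$: set $p=u\wedge e_x$, $q=p\wedge u$, $v=u-(u\cdot e_x)e_x$. If $q\cdot v>0$, set contact $=\mathfrak{b}$, $p'=e_y\wedge u$, $q'=Bq$. If $q\cdot v<0$, set contact $=\mathfrak{c}$, $p'=e_z\wedge u$, $q'=Cq$. - If contact $=\mathfrak{b}$: set $p=u\wedge e_y$, $q=p\wedge u$, $v=u-(u\cdot e_y)e_y$. If $q\cdot v>0$, set contact $=\mathfrak{c}$,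 $p'=e_z\wedge u$, $q'=Cq$. If $q\cdot v<0$, set contact $=\mathfrak{a}$, $p'=e_x\wedge u$, $q'=Aq$. - If contact $=\mathfrak{c}$: set $p=u\wedge e_z$, $q=p\wedge u$, $v=u-(u\cdot e_z)e_z$. If $q\cdot v>0$, set contact $=\mathfrak{a}$, $p'=e_x\wedge u$, $q'=Aq$. If $q\cdot v<0$, set contact $=\mathfrak{b}$, $p'=e_y\wedge u$, $q'=Bq$. 4. Compute $u'=q'\wedge p'$ and replace $u$ by $u'$. 5. If contact $=\mathfrak{b}$, stop and return $u'$; otherwise go back to step 3. The value $\widehat{\mathfrak{P}}(u)$ is the class in $\mathbb{P}_2(\mathbb{R})$ of the returned vector $u'$ (equivalently, $u'/|u'|$ up to sign). The degenerate situations $u\cdot e_x=0$, $u\cdot e_y=0$, $u\cdot e_z=0$ or $q\cdot v=0$ are excluded from the definition. *)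

theory Defs
  imports "HOL-Analysis.Analysis"
begin

datatype contact = Ca | Cb | Cc

fun succ_contact :: "contact \<Rightarrow> contact" where
  "succ_contact Ca = Cb"
| "succ_contact Cb = Cc"
| "succ_contact Cc = Ca"

fun pred_contact :: "contact \<Rightarrow> contact" where
  "pred_contact Ca = Cc"
| "pred_contact Cb = Ca"
| "pred_contact Cc = Cb"

fun basis_vec :: "contact \<Rightarrow> real^3" where
  "basis_vec Ca = axis 1 1"
| "basis_vec Cb = axis 2 1"
| "basis_vec Cc = axis 3 1"

definition alpha :: "real \<Rightarrow> real" where
  "alpha r = (1 + r) / 2"

fun collision_matrix :: "real \<Rightarrow> contact \<Rightarrow> real^3^3" where
  "collision_matrix r Ca = vector [
     vector [-r, 0, 0],
     vector [alpha r, 1, 0],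
     vector [0, 0, 1]]"
| "collision_matrix r Cb = vector [
     vector [1, alpha r, 0],
     vector [0, -r, 0],
     vector [0, alpha r, 1]]"
| "collision_matrix r Cc = vector [
     vector [1, 0, 0],
     vector [0, 1, alpha r],
     vector [0, 0, -r]]"

text \<open>One pass through the loop of the algorithm, from the current contact and normal vector to the
  new ones. The branches for the three contacts differ only by a cyclic shift: a positive \<open>q \<bullet> v\<close>
  leads to the next contact in the order a, b, c, a and a negative one to the previous contact.
  The result is \<open>None\<close> in the degenerate situations, which are tested for the current vector at every
  pass.\<close>

definition pass :: "real \<Rightarrow> contact \<Rightarrow> real^3 \<Rightarrow> (contact \<times> (real^3)) option" where
  "pass r c u =
    (let p = cross3 u (basis_vec c);
         q = cross3 p u;
         v = u - (u \<bullet> basis_vec c) *\<^sub>R basis_vec c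
     in if (\<exists>d. u \<bullet> basis_vec d = 0) \<or> q \<bullet> v = 0 then None
        else
          (let c' = (if q \<bullet> v > 0 then succ_contact c else pred_contact c);
               p' = cross3 (basis_vec c') u;
               q' = collision_matrix r c' *v q
           in Some (c', cross3 q' p')))"

text \<open>The loop ends on return to contact b. It also yields \<open>None\<close> if it does not terminate.\<close>

partial_function (option) loop :: "real \<Rightarrow> contact \<Rightarrow> real^3 \<Rightarrow> (real^3) option" where
  "loop r c u =
    (case pass r c u of
       None \<Rightarrow> None
     | Some (c', u') \<Rightarrow> if c' = Cb then Some u' else loop r c' u')"

definition same_up_to_sign :: "real^3 \<Rightarrow> real^3 \<Rightarrow> bool" where
  "same_up_to_sign u v \<longleftrightarrow> norm u = 1 \<and> norm v = 1 \<and> (u = v \<or> u = - v)"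

text \<open>The real projective plane, as the set of unit vectors up to sign. Its abstraction function is
  meaningful only on unit vectors.\<close>

quotient_type proj_plane = "real^3" / partial: same_up_to_sign
  morphisms rep_proj_plane proj_class
proof (rule part_equivpI)
  show "\<exists>u. same_up_to_sign u u"
    by (rule exI[of _ "axis 1 1"]) (simp add: same_up_to_sign_def)
  show "symp same_up_to_sign"
    by (auto simp: symp_def same_up_to_sign_def)
  show "transp same_up_to_sign"
    by (auto simp: transp_def same_up_to_sign_def)
qed

definition P_hat :: "real \<Rightarrow> real^3 \<Rightarrow> proj_plane option" where
  "P_hat r u =
    map_option (\<lambda>u'. proj_class (u' /\<^sub>R norm u'))
      (loop r Cb (if u \<bullet> basis_vec Ca < 0 then - u else u))"

definition X_domain :: "(real^3) set" where
  "X_domain = {u. (u$1)\<^sup>2 + (u$2)\<^sup>2 + (u$3)\<^sup>2 = 1} \<inter>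
       ({u. u$1 \<ge> 0 \<and> u$3 \<le> 0} \<union> {u. u$1 \<le> 0 \<and> u$3 \<ge> 0})"

definition P1 :: "real \<Rightarrow> real^3^3" where
  "P1 r = vector [
     vector [-r, r * alpha r, 0],
     vector [- alpha r, (alpha r)\<^sup>2 - r, r * alpha r],
     vector [0, 0, r\<^sup>2]]"

definition P2 :: "real \<Rightarrow> real^3^3" where
  "P2 r = vector [
     vector [r, - r * alpha r, 0],
     vector [alpha r, - 2 * (alpha r)\<^sup>2 + r, alpha r],
     vector [0, - r * alpha r, r]]"

definition P3 :: "real \<Rightarrow> real^3^3" where
  "P3 r = vector [
     vector [r\<^sup>2, 0, 0],
     vector [r * alpha r, (alpha r)\<^sup>2 - r, - alpha r],
     vector [0, r * alpha r, -r]]"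

definition P4 :: "real \<Rightarrow> real^3^3" where
  "P4 r = P2 r"

definition P_pos :: "real \<Rightarrow> real^3 \<Rightarrow> real^3" where
  "P_pos r u =
    (if u$2 > 0 \<and> alpha r * u$2 - u$1 > 0 then P1 r *v u
     else if u$2 > 0 \<and> alpha r * u$2 - u$1 < 0 then P2 r *v u
     else if u$2 < 0 \<and> alpha r * u$2 - u$3 < 0 then P3 r *v u
     else if u$2 < 0 \<and> alpha r * u$2 - u$3 > 0 then P4 r *v u
     else undefined)"

definition P_frak :: "real \<Rightarrow> real^3 \<Rightarrow> real^3" where
  "P_frak r u =
    (if u$1 > 0 \<and> u$3 < 0 then P_pos r u
     else if u$1 < 0 \<and> u$3 > 0 then - P_pos r (- u)
     else undefined)"

text \<open>The surface measure of the unit sphere, as a measure on the whole space: the area of a subset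
  of the sphere is three times the volume of the cone over it, i.e. of its radial preimage
  in the unit ball.\<close>

definition sphere_measure :: "(real^3) measure" where
  "sphere_measure =
    scale_measure 3 (distr (restrict_space lborel (cball 0 1)) borel sgn)"

end

theory Submission
  imports Defs
begin

text \<open>
  The planes followed by the algorithm are described by normal vectors. The matrix of a collision at
  contact \<open>d\<close> carries the plane normal to \<open>u\<close> to a new plane, and normals are transported by its
  cofactor matrix, called \<open>normal_matrix r d\<close> below. The algorithm does exactly this: \<open>q\<close> and
  \<open>p' = e\<^sub>d \<and> u\<close> span the old plane, and the collision fixes \<open>p'\<close>, which is orthogonal to
  \<open>e\<^sub>d\<close>. Hence \<open>u' = q' \<and> p'\<close> is the cofactor matrix applied to \<open>q \<and> p'\<close>, a multiple of \<open>u\<close>. The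
  sign that selects the branch at contact \<open>c\<close> is opposite to that of \<open>u \<bullet> e\<^sub>c\<close>. This is
  lemma \<open>pass_eq\<close>: one pass is a linear map, up to an explicit scalar, in a region given by the sign of
  one coordinate.

  After the normalisation \<open>x > 0\<close>, \<open>z < 0\<close>, the first branch depends on the sign of \<open>y\<close>, and the next
  one on the sign of \<open>\<alpha>y - x\<close> or \<open>\<alpha>y - z\<close>. If a third pass occurs, its branch is
  then forced. So the possible itineraries are b-a-b, b-a-c-b, b-c-b and b-c-a-b, and the products of
  the corresponding normal matrices are, up to a factor \<open>r\<close> for the longer ones, \<open>P\<^sub>1\<close>, \<open>P\<^sub>2\<close>,
  \<open>P\<^sub>3\<close> and \<open>P\<^sub>4\<close>. The scalars gathered along the way are nonzero and disappear in the projective plane.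

  The five inequations that exclude the degenerate situations remove only planes through the origin.
  The cone over the trace of such a plane on the sphere lies in the plane, so the trace has measure
  zero.
\<close>

text \<open>The cofactor matrix of \<open>collision_matrix r c\<close>, i.e. its inverse transpose multiplied by its
  determinant \<open>-r\<close>.\<close>

fun normal_matrix :: "real \<Rightarrow> contact \<Rightarrow> real^3^3" where
  "normal_matrix r Ca = vector [
     vector [1, - alpha r, 0],
     vector [0, -r, 0],
     vector [0, 0, -r]]"
| "normal_matrix r Cb = vector [
     vector [-r, 0, 0],
     vector [- alpha r, 1, - alpha r],
     vector [0, 0, -r]]"
| "normal_matrix r Cc = vector [
     vector [-r, 0, 0],
     vector [0, -r, 0],
     vector [0, - alpha r, 1]]"

lemmas coord3_simps =
  vec_eq_iff forall_3 sum_3 matrix_vector_mult_def matrix_matrix_mult_def inner_vec_def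
  vector_3 axis_def cross3_def

lemma cross3_collision_matrix:
  "cross3 (collision_matrix r c *v q) (collision_matrix r c *v p) = normal_matrix r c *v cross3 q p"
  by (cases c) (simp_all add: coord3_simps alpha_def field_simps)

text \<open>The matrix differs from the identity only in the column of the contact \<open>c\<close>.\<close>

lemma collision_matrix_fixes:
  assumes "p \<bullet> basis_vec c = 0"
  shows "collision_matrix r c *v p = p"
  using assms by (cases c) (simp_all add: coord3_simps)

lemma norm_basis_vec [simp]: "basis_vec c \<bullet> basis_vec c = 1"
  by (cases c) (simp_all add: coord3_simps)

lemma basis_vec_orthogonal: "c \<noteq> d \<Longrightarrow> basis_vec c \<bullet> basis_vec d = 0"
  by (cases c; cases d) (simp_all add: coord3_simps)

lemma cross3_cross3_left: "cross3 (cross3 a b) c = (a \<bullet> c) *\<^sub>R b - (b \<bullet> c) *\<^sub>R a"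
  by (simp add: coord3_simps algebra_simps)

lemma inner_basis_vec [simp]:
  "u \<bullet> basis_vec Ca = u$1" "u \<bullet> basis_vec Cb = u$2" "u \<bullet> basis_vec Cc = u$3"
  by (simp_all add: inner_axis)

declare basis_vec.simps [simp del]

text \<open>Up to a scalar, one pass applies the normal matrix of the contact that it moves to. The scalar is
  kept explicit because its sign enters the choice of branch at the following pass.\<close>

lemma pass_eq:
  fixes u :: "real^3"
  assumes nz: "u$1 \<noteq> 0" "u$2 \<noteq> 0" "u$3 \<noteq> 0"
    and d: "d = (if u \<bullet> basis_vec c < 0 then succ_contact c else pred_contact c)"
  shows "pass r c u =
    Some (d, ((u \<bullet> basis_vec c) * (u \<bullet> basis_vec d)) *\<^sub>R (normal_matrix r d *v u))"
proof -
  define q where "q = cross3 (cross3 u (basis_vec c)) u"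
  define v where "v = u - (u \<bullet> basis_vec c) *\<^sub>R basis_vec c"
  have q: "q = (u \<bullet> u) *\<^sub>R basis_vec c - (u \<bullet> basis_vec c) *\<^sub>R u"
    by (simp add: q_def cross3_cross3_left inner_commute)
  have qu: "q \<bullet> u = 0"
    by (simp add: q_def dot_cross_self)
  have nzb: "u \<bullet> basis_vec e \<noteq> 0" for e
    using nz by (cases e) simp_all
  \<comment> \<open>The projection \<open>v\<close> does not vanish, because its other two coordinates are those of \<open>u\<close>.\<close>
  have pos: "v \<bullet> v > 0"
  proof -
    have "v \<bullet> basis_vec (succ_contact c) = u \<bullet> basis_vec (succ_contact c)"
    proof -
      have "c \<noteq> succ_contact c" by (cases c) auto
      then show ?thesis by (simp add: v_def inner_diff_left basis_vec_orthogonal)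
    qed
    then have "v \<noteq> 0"
      using nzb by (metis inner_zero_left)
    then show ?thesis by simp
  qed
  have qv: "q \<bullet> v = - (u \<bullet> basis_vec c) * (v \<bullet> v)"
    by (simp add: q v_def inner_diff_left inner_diff_right inner_commute algebra_simps)
  have signs: "q \<bullet> v \<noteq> 0" "q \<bullet> v > 0 \<longleftrightarrow> u \<bullet> basis_vec c < 0"
    using pos nzb[of c] by (auto simp: qv zero_less_mult_iff mult_less_0_iff simp del: inner_gt_zero_iff)
  have cd: "c \<noteq> d" by (cases c) (auto simp: d)
  \<comment> \<open>Both factors of \<open>u'\<close> are images under the collision, so its normal matrix can be pulled out.\<close>
  have "collision_matrix r d *v cross3 (basis_vec d) u = cross3 (basis_vec d) u"
    by (rule collision_matrix_fixes) (simp add: dot_cross_self)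
  then have "cross3 (collision_matrix r d *v q) (cross3 (basis_vec d) u)
      = normal_matrix r d *v cross3 q (cross3 (basis_vec d) u)"
    by (metis cross3_collision_matrix)
  also have "cross3 q (cross3 (basis_vec d) u) = - (q \<bullet> basis_vec d) *\<^sub>R u"
    by (simp add: Lagrange qu)
  also have "- (q \<bullet> basis_vec d) = (u \<bullet> basis_vec c) * (u \<bullet> basis_vec d)"
    using cd by (simp add: q inner_diff_left basis_vec_orthogonal)
  finally have "cross3 (collision_matrix r d *v q) (cross3 (basis_vec d) u)
      = ((u \<bullet> basis_vec c) * (u \<bullet> basis_vec d)) *\<^sub>R (normal_matrix r d *v u)"
    by (simp add: matrix_vector_mult_scaleR)
  then show ?thesis
    using signs nzb by (simp add: pass_def Let_def d flip: q_def v_def)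
qed

lemma loop_eq:
  fixes u :: "real^3"
  assumes "u$1 \<noteq> 0" "u$2 \<noteq> 0" "u$3 \<noteq> 0"
    and "d = (if u \<bullet> basis_vec c < 0 then succ_contact c else pred_contact c)"
    and "w = ((u \<bullet> basis_vec c) * (u \<bullet> basis_vec d)) *\<^sub>R (normal_matrix r d *v u)"
  shows "loop r c u = (if d = Cb then Some w else loop r d w)"
  using pass_eq[OF assms(1-4)] by (subst loop.simps) (simp add: assms(5))

text \<open>The rightmost factor belongs to the contact that is reached first. The extra factor \<open>r\<close> in the
  products of three matrices is projectively irrelevant.\<close>

lemma normal_matrix_products:
  "normal_matrix r Cb ** normal_matrix r Ca = P1 r"
  "normal_matrix r Cb ** normal_matrix r Cc ** normal_matrix r Ca = r *\<^sub>R P2 r"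
  "normal_matrix r Cb ** normal_matrix r Cc = P3 r"
  "normal_matrix r Cb ** normal_matrix r Ca ** normal_matrix r Cc = r *\<^sub>R P4 r"
  by (simp_all add: coord3_simps P1_def P2_def P3_def P4_def algebra_simps power2_eq_square)

lemma normal_matrix_vector:
  "(normal_matrix r Ca *v u)$1 = u$1 - alpha r * u$2"
  "(normal_matrix r Ca *v u)$2 = - r * u$2"
  "(normal_matrix r Ca *v u)$3 = - r * u$3"
  "(normal_matrix r Cc *v u)$1 = - r * u$1"
  "(normal_matrix r Cc *v u)$2 = - r * u$2"
  "(normal_matrix r Cc *v u)$3 = u$3 - alpha r * u$2"
  by (simp_all add: coord3_simps)

declare normal_matrix.simps [simp del]

text \<open>In each case the vectors \<open>w\<close> and \<open>s\<close> reached after one and two passes are computed with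
  their scalars. The signs of their coordinates show that no degenerate situation occurs and determine
  the itinerary. The third pass always returns to b: from c because there \<open>s$3 > 0\<close>, and
  from a because there \<open>s$1 < 0\<close>.\<close>

lemma loop_Cb_pos:
  fixes u :: "real^3"
  assumes r: "0 < r" and x: "u$1 > 0" and z: "u$3 < 0" and y: "u$2 \<noteq> 0"
    and ax: "alpha r * u$2 - u$1 \<noteq> 0" and az: "alpha r * u$2 - u$3 \<noteq> 0"
  shows "\<exists>k. k \<noteq> 0 \<and> loop r Cb u = Some (k *\<^sub>R P_pos r u)"
proof -
  have \<alpha>: "alpha r > 0" using r by (simp add: alpha_def)
  have nz: "u$1 \<noteq> 0" "u$2 \<noteq> 0" "u$3 \<noteq> 0" using x y z by auto
  consider (1) "u$2 > 0" "alpha r * u$2 - u$1 > 0" | (2) "u$2 > 0" "alpha r * u$2 - u$1 < 0"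
    | (3) "u$2 < 0" "alpha r * u$2 - u$3 < 0" | (4) "u$2 < 0" "alpha r * u$2 - u$3 > 0"
    using y ax az by linarith
  then show ?thesis
  proof cases
    case 1
    define k where "k = u$2 * u$1"
    define w where "w = k *\<^sub>R (normal_matrix r Ca *v u)"
    have k: "k > 0" using 1 x by (simp add: k_def)
    have w1: "w$1 < 0" and w2: "w$2 < 0" and w3: "w$3 > 0"
      using 1 x z r k by (auto simp: w_def normal_matrix_vector mult_less_0_iff zero_less_mult_iff)
    have "loop r Cb u = loop r Ca w"
      using loop_eq[OF nz, of Ca Cb w] 1 by (simp add: w_def k_def)
    also have "\<dots> = Some ((w$1 * w$2) *\<^sub>R (normal_matrix r Cb *v w))"
      using w1 w2 w3 by (subst loop_eq[where d = Cb]) auto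
    also have "normal_matrix r Cb *v w = k *\<^sub>R (P1 r *v u)"
      by (simp add: w_def matrix_vector_mult_scaleR matrix_vector_mul_assoc normal_matrix_products)
    also have "P1 r *v u = P_pos r u" using 1 by (simp add: P_pos_def)
    finally show ?thesis using w1 w2 k by (intro exI[of _ "w$1 * w$2 * k"]) simp
  next
    case 2
    define k where "k = u$2 * u$1"
    define w where "w = k *\<^sub>R (normal_matrix r Ca *v u)"
    define l where "l = w$1 * w$3"
    define s where "s = l *\<^sub>R (normal_matrix r Cc *v w)"
    have k: "k > 0" using 2 x by (simp add: k_def)
    have w1: "w$1 > 0" and w2: "w$2 < 0" and w3: "w$3 > 0"
      using 2 x z r k by (auto simp: w_def normal_matrix_vector mult_less_0_iff zero_less_mult_iff)
    have l: "l > 0" using w1 w3 by (simp add: l_def)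
    have "alpha r * w$2 < w$3" using mult_pos_neg[OF \<alpha> w2] w3 by linarith
    then have s1: "s$1 < 0" and s2: "s$2 > 0" and s3: "s$3 > 0"
      using w1 w2 w3 r l by (auto simp: s_def normal_matrix_vector mult_less_0_iff zero_less_mult_iff)
    have "loop r Cb u = loop r Ca w"
      using loop_eq[OF nz, of Ca Cb w] 2 by (simp add: w_def k_def)
    also have "\<dots> = loop r Cc s"
      using w1 w2 w3 by (subst loop_eq[where d = Cc]) (auto simp: s_def l_def)
    also have "\<dots> = Some ((s$3 * s$2) *\<^sub>R (normal_matrix r Cb *v s))"
      using s1 s2 s3 by (subst loop_eq[where d = Cb]) auto
    also have "normal_matrix r Cb *v s = (l * k * r) *\<^sub>R (P2 r *v u)"
      by (simp add: s_def w_def matrix_vector_mult_scaleR matrix_vector_mul_assoc matrix_mul_assoc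
          normal_matrix_products(2) scaleR_matrix_vector_assoc[symmetric])
    also have "P2 r *v u = P_pos r u" using 2 by (simp add: P_pos_def)
    finally show ?thesis using s2 s3 l k r by (intro exI[of _ "s$3 * s$2 * (l * k * r)"]) simp
  next
    case 3
    define k where "k = u$2 * u$3"
    define w where "w = k *\<^sub>R (normal_matrix r Cc *v u)"
    have k: "k > 0" using 3 z by (simp add: k_def mult_neg_neg)
    have w1: "w$1 < 0" and w2: "w$2 > 0" and w3: "w$3 > 0"
      using 3 x z r k by (auto simp: w_def normal_matrix_vector mult_less_0_iff zero_less_mult_iff)
    have "loop r Cb u = loop r Cc w"
      using loop_eq[OF nz, of Cc Cb w] 3 by (simp add: w_def k_def)
    also have "\<dots> = Some ((w$3 * w$2) *\<^sub>R (normal_matrix r Cb *v w))"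
      using w1 w2 w3 by (subst loop_eq[where d = Cb]) auto
    also have "normal_matrix r Cb *v w = k *\<^sub>R (P3 r *v u)"
      by (simp add: w_def matrix_vector_mult_scaleR matrix_vector_mul_assoc normal_matrix_products)
    also have "P3 r *v u = P_pos r u" using 3 by (simp add: P_pos_def)
    finally show ?thesis using w3 w2 k by (intro exI[of _ "w$3 * w$2 * k"]) simp
  next
    case 4
    define k where "k = u$2 * u$3"
    define w where "w = k *\<^sub>R (normal_matrix r Cc *v u)"
    define l where "l = w$3 * w$1"
    define s where "s = l *\<^sub>R (normal_matrix r Ca *v w)"
    have k: "k > 0" using 4 z by (simp add: k_def mult_neg_neg)
    have w1: "w$1 < 0" and w2: "w$2 > 0" and w3: "w$3 < 0"
      using 4 x z r k by (auto simp: w_def normal_matrix_vector mult_less_0_iff zero_less_mult_iff)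
    have l: "l > 0" using w1 w3 by (simp add: l_def mult_neg_neg)
    have "alpha r * w$2 > w$1" using mult_pos_pos[OF \<alpha> w2] w1 by linarith
    then have s1: "s$1 < 0" and s2: "s$2 < 0" and s3: "s$3 > 0"
      using w1 w2 w3 r l by (auto simp: s_def normal_matrix_vector mult_less_0_iff zero_less_mult_iff)
    have "loop r Cb u = loop r Cc w"
      using loop_eq[OF nz, of Cc Cb w] 4 by (simp add: w_def k_def)
    also have "\<dots> = loop r Ca s"
      using w1 w2 w3 by (subst loop_eq[where d = Ca]) (auto simp: s_def l_def)
    also have "\<dots> = Some ((s$1 * s$2) *\<^sub>R (normal_matrix r Cb *v s))"
      using s1 s2 s3 by (subst loop_eq[where d = Cb]) auto
    also have "normal_matrix r Cb *v s = (l * k * r) *\<^sub>R (P4 r *v u)"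
      by (simp add: s_def w_def matrix_vector_mult_scaleR matrix_vector_mul_assoc matrix_mul_assoc
          normal_matrix_products(4) scaleR_matrix_vector_assoc[symmetric])
    also have "P4 r *v u = P_pos r u" using 4 by (simp add: P_pos_def)
    finally show ?thesis using s1 s2 l k r by (intro exI[of _ "s$1 * s$2 * (l * k * r)"]) simp
  qed
qed

text \<open>In every case one coordinate of the image is a nonzero multiple of a quantity assumed not to
  vanish: the third for \<open>P\<^sub>1\<close> and \<open>P\<^sub>4\<close>, the first for \<open>P\<^sub>2\<close> and \<open>P\<^sub>3\<close>.\<close>

lemma P_pos_nonzero:
  fixes u :: "real^3"
  assumes r: "0 < r" and x: "u$1 > 0" and z: "u$3 < 0" and y: "u$2 \<noteq> 0"
    and ax: "alpha r * u$2 - u$1 \<noteq> 0" and az: "alpha r * u$2 - u$3 \<noteq> 0"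
  shows "P_pos r u \<noteq> 0"
proof
  assume "P_pos r u = 0"
  then show False
    using assms by (auto simp: P_pos_def P1_def P2_def P3_def P4_def coord3_simps algebra_simps split: if_splits)
qed

lemma proj_class_scaleR:
  assumes "k \<noteq> 0" "w \<noteq> 0"
  shows "proj_class ((k *\<^sub>R w) /\<^sub>R norm (k *\<^sub>R w)) = proj_class (w /\<^sub>R norm w)"
proof -
  have "same_up_to_sign ((k *\<^sub>R w) /\<^sub>R norm (k *\<^sub>R w)) (w /\<^sub>R norm w)"
    using assms by (cases "k > 0") (auto simp: same_up_to_sign_def field_simps)
  then show ?thesis
    by (rule Quotient3_rel_abs[OF Quotient3_proj_plane])
qed

lemma P_hat_eq:
  fixes u :: "real^3"
  assumes r: "0 < r" and "u \<in> X_domain" and x: "u$1 \<noteq> 0" and y: "u$2 \<noteq> 0" and z: "u$3 \<noteq> 0"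
    and ax: "alpha r * u$2 - u$1 \<noteq> 0" and az: "alpha r * u$2 - u$3 \<noteq> 0"
  shows "P_frak r u \<noteq> 0 \<and> P_hat r u = Some (proj_class (P_frak r u /\<^sub>R norm (P_frak r u)))"
proof -
  \<comment> \<open>Both the algorithm and \<open>P_frak\<close> reduce to the representative with positive first coordinate.\<close>
  have main: "P_pos r w \<noteq> 0 \<and> (\<exists>k. k \<noteq> 0 \<and> loop r Cb w = Some (k *\<^sub>R P_pos r w))"
    if "w$1 > 0" "w$3 < 0" "w = u \<or> w = - u" for w
    using that r y ax az P_pos_nonzero[of r w] loop_Cb_pos[of r w] by auto
  consider "u$1 > 0" "u$3 < 0" | "u$1 < 0" "u$3 > 0"
    using assms(2) x z by (auto simp: X_domain_def)
  then show ?thesis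
  proof cases
    case 1
    then show ?thesis
      using main[of u] proj_class_scaleR
      by (auto simp: P_hat_def P_frak_def)
  next
    case 2
    then obtain k where "P_pos r (-u) \<noteq> 0" "k \<noteq> 0" "loop r Cb (-u) = Some (k *\<^sub>R P_pos r (-u))"
      using main[of "-u"] by auto
    moreover from this have "proj_class ((k *\<^sub>R P_pos r (-u)) /\<^sub>R norm (k *\<^sub>R P_pos r (-u)))
      = proj_class ((- P_pos r (-u)) /\<^sub>R norm (- P_pos r (-u)))"
      using proj_class_scaleR[of k "P_pos r (-u)"] proj_class_scaleR[of "-1" "P_pos r (-u)"] by simp
    ultimately show ?thesis
      using 2 by (simp add: P_hat_def P_frak_def)
  qed
qed

text \<open>The measure of a subset of the sphere is defined from the cone over it. Since \<open>a \<bullet> sgn x = 0\<close>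
  holds exactly when \<open>a \<bullet> x = 0\<close>, the cone over a great circle lies in a plane, which is Lebesgue-null.\<close>

lemma AE_sphere_measure_off_plane:
  fixes a :: "real^3"
  assumes "a \<noteq> 0"
  shows "AE u in sphere_measure. a \<bullet> u \<noteq> 0"
proof -
  let ?B = "restrict_space lborel (cball (0::real^3) 1)"
  let ?H = "{x. a \<bullet> x = 0}"
  have [measurable]: "(sgn :: real^3 \<Rightarrow> _) \<in> borel_measurable borel"
    unfolding sgn_div_norm by measurable
  have "?H \<in> null_sets lborel"
    using negligible_hyperplane[of a 0] assms
    by (simp add: negligible_iff_null_sets null_sets_completion_iff)
  then have "AE x in ?B. a \<bullet> x \<noteq> 0"
    using AE_not_in by (fastforce simp: AE_restrict_space_iff)
  then have "AE x in ?B. a \<bullet> sgn x \<noteq> 0"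
    by eventually_elim (auto simp: sgn_div_norm)
  then have "AE u in distr ?B borel sgn. a \<bullet> u \<noteq> 0"
    by (subst AE_distr_iff) (auto intro!: measurable_restrict_space1)
  then show ?thesis
    by (auto simp: sphere_measure_def eventually_ae_filter null_sets_def)
qed

theorem theorem3p3:
  fixes r :: real
  assumes "0 < r" and "r < 1"
  shows "(AE u in sphere_measure. u \<in> X_domain \<longrightarrow>
            P_frak r u \<noteq> 0 \<and>
            P_hat r u = Some (proj_class (P_frak r u /\<^sub>R norm (P_frak r u)))) \<and>
         (\<forall>u\<in>X_domain. u$1 \<noteq> 0 \<and> u$2 \<noteq> 0 \<and> u$3 \<noteq> 0 \<and>
            alpha r * u$2 - u$1 \<noteq> 0 \<and> alpha r * u$2 - u$3 \<noteq> 0 \<longrightarrow>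
            P_frak r u \<noteq> 0 \<and>
            P_hat r u = Some (proj_class (P_frak r u /\<^sub>R norm (P_frak r u))))"
proof (intro conjI ballI impI)
  have "AE u in sphere_measure. axis 1 1 \<bullet> u \<noteq> 0"
    "AE u in sphere_measure. axis 2 1 \<bullet> u \<noteq> 0"
    "AE u in sphere_measure. axis 3 1 \<bullet> u \<noteq> 0"
    "AE u in sphere_measure. vector [-1, alpha r, 0] \<bullet> u \<noteq> 0"
    "AE u in sphere_measure. vector [0, alpha r, -1] \<bullet> u \<noteq> 0"
    by (rule AE_sphere_measure_off_plane, simp add: coord3_simps)+
  then show "AE u in sphere_measure. u \<in> X_domain \<longrightarrow>
      P_frak r u \<noteq> 0 \<and>
      P_hat r u = Some (proj_class (P_frak r u /\<^sub>R norm (P_frak r u)))"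
    by eventually_elim (intro impI P_hat_eq assms; simp add: coord3_simps)
qed (use P_hat_eq[OF assms(1)] in blast)+

end
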